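(* Let $n\geq 1$ and let $T\colon \mathbb{R}^n\times X\to X$ be a continuous action of the additive group $\mathbb{R}^n$ on a compact metrizable space $X$. Then $(X,T)$ equivariantly embeds in $\mathrm{Lip}_1(\mathbb{R}^n,[0,1])$ if and only if the fixed point set $\mathrm{Fix}(X,T)$ topologically embeds in the unit interval $[0,1]$.
   Context: Write $T^t x = T(t,x)$. $\mathbb{R}^n$ carries the Euclidean topology, the Euclidean norm $|t|=\sqrt{t_1^2+\dots+t_n^2}$ and its additive group structure. $\mathrm{Fix}(X,T)=\{x\in X\mid T^t x=x \text{ for all } t\in\mathbb{R}^n\}$, with the subspace topology. $\mathrm{Lip}_1(\mathbb{R}^n,[0,1])$ is the space of all maps $\varphi\colon\mathbb{R}^n\to[0,1]$ with $|\varphi(t)-\varphi(u)|\leq|t-u|$ for all $t,u\in\mathbb{R}^n$, endowed with the compact-open topology (uniform convergence on compact subsets); it is compact and metrizable. $\mathbb{R}^n$ acts continuously on it by the shift $\sigma$: $(\sigma^u\varphi)(t)=\varphi(t+u)$. $(X,T)$ equivariantly embeds in $\mathrm{Lip}_1(\mathbb{R}^n,[0,1])$ if there exists a topological embedding (homeomorphism onto its image) $f\colon X\to\mathrm{Lip}_1(\mathbb{R}^n,[0,1])$ with $f\circ T^t=\sigma^t\circ f$ for all $t\in\mathbb{R}^n$. *)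

theory Defs
  imports "HOL-Analysis.Analysis"
begin

definition continuous_action :: "'a topology \<Rightarrow> (real ^ 'n \<Rightarrow> 'a \<Rightarrow> 'a) \<Rightarrow> bool" where
  "continuous_action X T \<longleftrightarrow>
     continuous_map (prod_topology euclidean X) X (\<lambda>(t, x). T t x) \<and>
     (\<forall>x \<in> topspace X. T 0 x = x) \<and>
     (\<forall>s t. \<forall>x \<in> topspace X. T (s + t) x = T s (T t x))"

definition fixed_points :: "'a topology \<Rightarrow> (real ^ 'n \<Rightarrow> 'a \<Rightarrow> 'a) \<Rightarrow> 'a set" where
  "fixed_points X T = {x \<in> topspace X. \<forall>t. T t x = x}"

definition compact_open_topology ::
    "('b::topological_space \<Rightarrow> 'c::topological_space) topology" where
  "compact_open_topology =
     topology_generated_by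
       {{f. continuous_on UNIV f \<and> f ` K \<subseteq> U} | K U. compact K \<and> open U}"

definition Lip1 :: "(real ^ 'n \<Rightarrow> real) set" where
  "Lip1 = {\<phi>. range \<phi> \<subseteq> {0..1} \<and> 1-lipschitz_on UNIV \<phi>}"

text \<open>The functions are regarded as real-valued; since \<open>{0..1}\<close> carries the subspace
  topology, this is the same as the compact-open topology for maps into \<open>{0..1}\<close>.\<close>

definition Lip1_topology :: "(real ^ 'n \<Rightarrow> real) topology" where
  "Lip1_topology = subtopology compact_open_topology Lip1"

definition shift :: "real ^ 'n \<Rightarrow> (real ^ 'n \<Rightarrow> real) \<Rightarrow> real ^ 'n \<Rightarrow> real" where
  "shift u \<phi> = (\<lambda>t. \<phi> (t + u))"

definition equivariantly_embeds_in_Lip1 ::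
    "'a topology \<Rightarrow> (real ^ 'n \<Rightarrow> 'a \<Rightarrow> 'a) \<Rightarrow> bool" where
  "equivariantly_embeds_in_Lip1 X T \<longleftrightarrow>
     (\<exists>f. embedding_map X Lip1_topology f \<and>
          (\<forall>t. \<forall>x \<in> topspace X. f (T t x) = shift t (f x)))"

lemma topspace_compact_open_topology:
  "topspace compact_open_topology = {f. continuous_on UNIV f}"
proof -
  have "{f. continuous_on UNIV f} \<in>
      {{f. continuous_on UNIV f \<and> f ` K \<subseteq> U} | K U. compact K \<and> open U}"
    by (rule CollectI, rule exI[of _ "{}"], rule exI[of _ UNIV]) simp
  then show ?thesis
    unfolding compact_open_topology_def topology_generated_by_topspace by blast
qed

lemma topspace_Lip1_topology [simp]: "topspace Lip1_topology = Lip1"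
proof -
  have "Lip1 \<subseteq> {f. continuous_on UNIV f}"
    using lipschitz_on_continuous_on by (auto simp only: Lip1_def)
  then show ?thesis
    unfolding Lip1_topology_def topspace_subtopology topspace_compact_open_topology by blast
qed

lemma shift_Lip1:
  assumes "\<phi> \<in> Lip1" shows "shift u \<phi> \<in> Lip1"
proof -
  have "1-lipschitz_on UNIV \<phi>" and "range \<phi> \<subseteq> {0..1}"
    using assms by (simp_all only: Lip1_def mem_Collect_eq)
  then have "dist (\<phi> (s + u)) (\<phi> (t + u)) \<le> 1 * dist s t" for s t
    using lipschitz_onD[of 1 UNIV \<phi> "s + u" "t + u"] by (simp only: UNIV_I dist_add_cancel2)
  moreover have "range (shift u \<phi>) \<subseteq> range \<phi>"
    unfolding shift_def by blast
  ultimately show ?thesis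
    using \<open>range \<phi> \<subseteq> {0..1}\<close> unfolding Lip1_def lipschitz_on_def shift_def by simp
qed

end

theory Submission
  imports Defs
begin

text \<open>
  Fixed points must be sent to constant functions, so evaluation at \<open>0\<close> embeds the fixed point set
  in the interval. Conversely, it suffices to find a continuous \<open>f\<close> on \<open>X\<close> with values in \<open>[0,1]\<close> that is
  1-Lipschitz along orbits and separates the points of \<open>X\<close> along orbits: then
  \<open>x \<mapsto> (t \<mapsto> f (T\<^sup>t x))\<close> is the embedding. By Baire's theorem a generic \<open>f\<close> that is injective on the fixed
  points works, provided any two points \<open>p \<noteq> q\<close> with \<open>p\<close> not fixed have neighbourhoods whose points
  can be told apart after a small perturbation. To do so, make \<open>f\<close> slightly better than 1-Lipschitz
  along orbits, add a tiny but steep oscillation near \<open>p\<close>, and restore the Lipschitz bound by the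
  inf-convolution \<open>F \<mapsto> inf\<^sub>t (F (T\<^sup>t x) + |t|)\<close>. The result has slope exactly 1 on some piece of every
  orbit near \<open>p\<close>, but slope bounded away from 1 near \<open>q\<close>.
\<close>

section \<open>Projections along compact sets and the topology of \<open>Lip1\<close>\<close>

lemma closedin_compact_projection_euclidean:
  fixes \<Phi> :: "'c::t2_space \<Rightarrow> 'a \<Rightarrow> real"
  assumes "continuous_map (prod_topology euclidean X) euclideanreal (\<lambda>(t, x). \<Phi> t x)"
    and "compact C" and "closed S"
  shows "closedin X {x \<in> topspace X. \<exists>t\<in>C. \<Phi> t x \<in> S}"
proof -
  let ?P = "prod_topology (top_of_set C) X"
  have "?P = subtopology (prod_topology euclidean X) (C \<times> topspace X)"
    by (simp add: subtopology_Times)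
  then have "continuous_map ?P euclideanreal (\<lambda>(t, x). \<Phi> t x)"
    using assms(1) by (simp add: continuous_map_from_subtopology)
  then have cl: "closedin ?P {z \<in> topspace ?P. (\<lambda>(t, x). \<Phi> t x) z \<in> S}"
    using \<open>closed S\<close> by (intro closedin_continuous_map_preimage) auto
  \<comment> \<open>The factor \<open>C\<close> is compact, so the projection along it is closed.
    Later this gives semicontinuity of inf-convolutions and continuity into the compact-open
    topology.\<close>
  have "closed_map ?P X snd"
    using \<open>compact C\<close> by (intro closed_map_snd) (simp add: compact_space_subtopology)
  then have "closedin X (snd ` {z \<in> topspace ?P. (\<lambda>(t, x). \<Phi> t x) z \<in> S})"
    using cl by (simp add: closed_map_def)
  moreover have "snd ` {z \<in> topspace ?P. (\<lambda>(t, x). \<Phi> t x) z \<in> S}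
      = {x \<in> topspace X. \<exists>t\<in>C. \<Phi> t x \<in> S}"
    by force
  ultimately show ?thesis by simp
qed

lemma embedding_map_imp_continuous_map: "embedding_map X Y f \<Longrightarrow> continuous_map X Y f"
  unfolding embedding_map_def
  by (blast dest: homeomorphic_imp_continuous_map continuous_map_into_fulltopology)

lemma embedding_map_imp_injective: "embedding_map X Y f \<Longrightarrow> inj_on f (topspace X)"
  unfolding embedding_map_def by (rule homeomorphic_imp_injective_map)

lemma continuous_map_compact_open_evaluation:
  "continuous_map (compact_open_topology :: ('b::topological_space \<Rightarrow> 'c::topological_space) topology)
     euclidean (\<lambda>\<phi>. \<phi> t)"
proof -
  have "openin compact_open_topology {\<phi> \<in> topspace compact_open_topology. \<phi> t \<in> U}"
    if "open U" for U :: "'c set"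
  proof -
    have "{\<phi> :: 'b \<Rightarrow> 'c. \<phi> \<in> topspace compact_open_topology \<and> \<phi> t \<in> U}
        = {\<phi>. continuous_on UNIV \<phi> \<and> \<phi> ` {t} \<subseteq> U}"
      by (auto simp: topspace_compact_open_topology)
    moreover have "openin compact_open_topology {\<phi>. continuous_on UNIV \<phi> \<and> \<phi> ` {t} \<subseteq> U}"
      unfolding compact_open_topology_def
      by (rule topology_generated_by_Basis, rule CollectI, rule exI[of _ "{t}"], rule exI[of _ U])
        (simp add: that)
    ultimately show ?thesis by simp
  qed
  then show ?thesis
    by (simp add: continuous_map_def)
qed

lemma continuous_map_Lip1_evaluation: "continuous_map Lip1_topology euclideanreal (\<lambda>\<phi>. \<phi> t)"
  unfolding Lip1_topology_def
  by (intro continuous_map_from_subtopology continuous_map_compact_open_evaluation)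

text \<open>Evaluations are continuous and separate functions. A Hausdorff target is what turns a
  continuous injection of the compact space \<open>X\<close> into an embedding.\<close>

lemma Hausdorff_space_Lip1: "Hausdorff_space (Lip1_topology :: (real ^ 'n \<Rightarrow> real) topology)"
  unfolding Hausdorff_space_def
proof (intro allI impI, elim conjE)
  fix \<phi> \<psi> :: "real ^ 'n \<Rightarrow> real"
  assume mem: "\<phi> \<in> topspace Lip1_topology" "\<psi> \<in> topspace Lip1_topology" and "\<phi> \<noteq> \<psi>"
  then obtain t where "\<phi> t \<noteq> \<psi> t" by blast
  then obtain U V where UV: "open U" "open V" "\<phi> t \<in> U" "\<psi> t \<in> V" "U \<inter> V = {}"
    using hausdorff[of "\<phi> t" "\<psi> t"] by metis
  let ?pre = "\<lambda>W. {\<xi> \<in> topspace Lip1_topology. \<xi> t \<in> W}"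
  have "openin Lip1_topology (?pre U)" "openin Lip1_topology (?pre V)"
    using UV openin_continuous_map_preimage[OF continuous_map_Lip1_evaluation]
    by (simp_all only: open_openin)
  moreover have "disjnt (?pre U) (?pre V)"
    using UV by (auto simp: disjnt_def)
  ultimately show "\<exists>U V. openin Lip1_topology U \<and> openin Lip1_topology V \<and> \<phi> \<in> U \<and> \<psi> \<in> V \<and> disjnt U V"
    using mem UV by blast
qed

subsection \<open>Inf-convolution along orbits\<close>

locale compact_flow =
  fixes X :: "'a topology" and T :: "real ^ 'n \<Rightarrow> 'a \<Rightarrow> 'a"
  assumes compact_X: "compact_space X"
    and metrizable_X: "metrizable_space X"
    and action: "continuous_action X T"
begin

lemma Hausdorff_X: "Hausdorff_space X"
  using metrizable_X by (rule metrizable_imp_Hausdorff_space)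

lemma action_map: "continuous_map (prod_topology euclidean X) X (\<lambda>(t, x). T t x)"
  using action by (simp add: continuous_action_def)

lemma action_in_topspace [simp]: "x \<in> topspace X \<Longrightarrow> T t x \<in> topspace X"
  using continuous_map_image_subset_topspace[OF action_map] by force

lemma action_0 [simp]: "x \<in> topspace X \<Longrightarrow> T 0 x = x"
  using action by (simp add: continuous_action_def)

lemma action_action [simp]: "x \<in> topspace X \<Longrightarrow> T s (T t x) = T (s + t) x"
  using action by (simp add: continuous_action_def)

lemma continuous_map_action:
  assumes "continuous_map X Y F"
  shows "continuous_map (prod_topology euclidean X) Y (\<lambda>(t, x). F (T t x))"
  using continuous_map_compose[OF action_map assms] by (simp add: comp_def case_prod_unfold)

lemma continuous_map_time:
  assumes "continuous_map X Y F"
  shows "continuous_map X Y (\<lambda>x. F (T t x))"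
proof -
  have "continuous_map X (prod_topology euclidean X) (\<lambda>x. (t, x))"
    by (simp add: continuous_map_pairedI)
  from continuous_map_compose[OF this continuous_map_action[OF assms]]
  show ?thesis by (simp add: comp_def)
qed

lemma continuous_map_orbit:
  assumes "continuous_map X Y F" and "x \<in> topspace X"
  shows "continuous_map euclidean Y (\<lambda>t. F (T t x))"
proof -
  have "continuous_map euclidean (prod_topology euclidean X) (\<lambda>t. (t, x))"
    using assms(2) by (simp add: continuous_map_pairedI)
  from continuous_map_compose[OF this continuous_map_action[OF assms(1)]]
  show ?thesis by (simp add: comp_def)
qed

lemma continuous_on_orbit:
  fixes F :: "'a \<Rightarrow> real"
  assumes "continuous_map X euclideanreal F" and "x \<in> topspace X"
  shows "continuous_on A (\<lambda>t. F (T t x))"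
  using continuous_map_orbit[OF assms] continuous_on_subset by (auto simp: continuous_map_iff_continuous2)

lemma fixed_points_subset: "fixed_points X T \<subseteq> topspace X"
  by (auto simp: fixed_points_def)

lemma closedin_fixed_points: "closedin X (fixed_points X T)"
proof -
  have "fixed_points X T = \<Inter> (range (\<lambda>t. {x \<in> topspace X. T t x = x}))"
    by (auto simp: fixed_points_def)
  moreover have "closedin X {x \<in> topspace X. T t x = x}" for t
    using continuous_map_time[OF continuous_map_id, of t]
    by (intro closedin_continuous_maps_eq[OF Hausdorff_X]) (auto simp: id_def)
  ultimately show ?thesis
    by (auto intro: closedin_Inter)
qed

text \<open>The pairs \<open>(t, x)\<close> violating the bound form a closed set that misses
  \<open>t = 0\<close>. Compactness of \<open>X\<close> makes its projection to the times closed, so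
  a ball of times around 0 avoids it, uniformly in \<open>x\<close>.\<close>

lemma uniform_continuity_along_orbits:
  assumes F: "continuous_map X euclideanreal F" and "\<gamma> > 0"
  obtains \<rho> where "\<rho> > 0"
    and "\<And>t x. x \<in> topspace X \<Longrightarrow> norm t < \<rho> \<Longrightarrow> \<bar>F (T t x) - F x\<bar> < \<gamma>"
proof -
  let ?P = "prod_topology euclidean X :: ((real ^ 'n) \<times> 'a) topology"
  let ?S = "{z \<in> topspace ?P. (\<lambda>(t, x). \<bar>F (T t x) - F x\<bar>) z \<in> {\<gamma>..}}"
  have "continuous_map ?P euclideanreal (F \<circ> snd)"
    using F continuous_map_snd by (intro continuous_map_compose) 
  then have "continuous_map ?P euclideanreal (\<lambda>z. \<bar>(\<lambda>(t, x). F (T t x)) z - (F \<circ> snd) z\<bar>)"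
    by (intro continuous_map_real_abs continuous_map_diff continuous_map_action F)
  then have "continuous_map ?P euclideanreal (\<lambda>(t, x). \<bar>F (T t x) - F x\<bar>)"
    by (simp add: case_prod_unfold comp_def)
  then have "closedin ?P ?S"
    by (rule closedin_continuous_map_preimage) auto
  then have "closed (fst ` ?S)"
    using closed_map_fst[OF compact_X, of "euclidean :: (real ^ 'n) topology"]
    unfolding closed_map_def by (simp only: closed_closedin)
  moreover have "0 \<notin> fst ` ?S"
    using \<open>\<gamma> > 0\<close> by auto
  ultimately have "open (- fst ` ?S)" "0 \<in> - fst ` ?S"
    by (simp_all only: open_Compl Compl_iff simp_thms)
  then obtain \<rho> where "\<rho> > 0" and \<rho>: "ball 0 \<rho> \<subseteq> - fst ` ?S"
    by (rule openE)
  show thesis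
  proof
    fix t :: "real ^ 'n" and x assume *: "x \<in> topspace X" "norm t < \<rho>"
    then have "t \<notin> fst ` ?S" using \<rho> by (auto simp: subset_iff)
    then have "(t, x) \<notin> ?S" by force
    with * show "\<bar>F (T t x) - F x\<bar> < \<gamma>" by auto
  qed (fact \<open>\<rho> > 0\<close>)
qed

text \<open>The largest function below \<open>F\<close> that is 1-Lipschitz along orbits.\<close>

definition infconv :: "('a \<Rightarrow> real) \<Rightarrow> 'a \<Rightarrow> real" where
  "infconv F x = (INF t. F (T t x) + norm t)"

lemma infconv_le:
  assumes "\<And>x. x \<in> topspace X \<Longrightarrow> 0 \<le> F x" and "x \<in> topspace X"
  shows "infconv F x \<le> F (T t x) + norm t"
  unfolding infconv_def
proof (rule cINF_lower)
  show "bdd_below (range (\<lambda>t. F (T t x) + norm t))"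
    using assms by (intro bdd_belowI[of _ 0]) auto
qed simp

text \<open>Since \<open>0 \<le> F \<le> 1\<close>, a time of norm above 1 costs at least as much as
  staying at time 0, so a minimum over the compact unit ball is global.\<close>

lemma infconv_attained:
  assumes F: "continuous_map X euclideanreal F" and F01: "\<And>x. x \<in> topspace X \<Longrightarrow> F x \<in> {0..1}"
    and x: "x \<in> topspace X"
  obtains t where "norm t \<le> 1" and "infconv F x = F (T t x) + norm t"
proof -
  have "continuous_on (cball 0 1) (\<lambda>t. F (T t x) + norm t)"
    by (intro continuous_intros continuous_on_orbit F x)
  then obtain t where t: "t \<in> cball 0 1" and min: "\<And>s. s \<in> cball 0 1 \<Longrightarrow> F (T t x) + norm t \<le> F (T s x) + norm s"
    using continuous_attains_inf[of "cball 0 1" "\<lambda>t. F (T t x) + norm t"] by auto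
  have le: "F (T t x) + norm t \<le> F (T s x) + norm s" for s
  proof (cases "norm s \<le> 1")
    case False
    have "F (T t x) + norm t \<le> F x" using min[of 0] x by simp
    also have "\<dots> \<le> 1" using F01[OF x] by simp
    also have "\<dots> \<le> F (T s x) + norm s" using F01[of "T s x"] x False by simp
    finally show ?thesis .
  qed (simp add: min)
  have "infconv F x = F (T t x) + norm t"
    using F01 x by (intro antisym infconv_le) (auto simp: infconv_def intro!: cINF_greatest le)
  with t that show thesis by simp
qed

text \<open>If \<open>u\<close> is optimal at \<open>T s y\<close>, then \<open>u + s\<close>
  competes at \<open>y\<close>, and the triangle inequality bounds its cost. The reverse bound is
  the same one for the time \<open>- t\<close> started at \<open>T t x\<close>.\<close>

lemma infconv_Lipschitz:
  assumes F: "continuous_map X euclideanreal F" and F01: "\<And>x. x \<in> topspace X \<Longrightarrow> F x \<in> {0..1}"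
    and x: "x \<in> topspace X"
  shows "\<bar>infconv F (T t x) - infconv F x\<bar> \<le> norm t"
proof -
  have *: "infconv F y \<le> infconv F (T s y) + norm s" if y: "y \<in> topspace X" for s y
  proof -
    obtain u where u: "infconv F (T s y) = F (T u (T s y)) + norm u"
      using infconv_attained[OF F F01, of "T s y"] y by auto
    have "infconv F y \<le> F (T (u + s) y) + norm (u + s)"
      using F01 y by (intro infconv_le) auto
    with u y norm_triangle_ineq[of u s] show ?thesis by simp
  qed
  from *[OF x, of t] *[of "T t x" "- t"] x show ?thesis by simp
qed

lemma infconv_in_unit_interval:
  assumes F: "continuous_map X euclideanreal F" and F01: "\<And>x. x \<in> topspace X \<Longrightarrow> F x \<in> {0..1}"
    and x: "x \<in> topspace X"
  shows "infconv F x \<in> {0..1}"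
proof -
  obtain t where "infconv F x = F (T t x) + norm t"
    using infconv_attained[OF F F01 x] by blast
  moreover have "infconv F x \<le> F (T 0 x) + norm (0 :: real ^ 'n)"
    using F01 x by (intro infconv_le) auto
  ultimately show ?thesis
    using F01[of x] F01[of "T t x"] x by auto
qed

text \<open>On a one-point orbit moving gains nothing, so time 0 is optimal. Prescribed values on
  the fixed points therefore survive inf-convolution.\<close>

lemma infconv_fixed:
  assumes "x \<in> fixed_points X T" and "0 \<le> F x"
  shows "infconv F x = F x"
proof -
  have "(INF t :: real ^ 'n. F x + norm t) = F x"
    using assms(2) by (intro cInf_eq_minimum) (auto intro!: image_eqI[of _ _ 0])
  then show ?thesis
    using assms(1) by (simp add: infconv_def fixed_points_def)
qed

text \<open>Sublevel sets are closed because an optimal time lies in a compact ball; strict sublevel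
  sets are open because an infimum of continuous functions is upper semicontinuous.\<close>

lemma continuous_map_infconv:
  assumes F: "continuous_map X euclideanreal F" and F01: "\<And>x. x \<in> topspace X \<Longrightarrow> F x \<in> {0..1}"
  shows "continuous_map X euclideanreal (infconv F)"
  unfolding continuous_map_upper_lower_semicontinuous_lte
proof (intro allI conjI)
  fix a
  let ?P = "prod_topology euclidean X :: ((real ^ 'n) \<times> 'a) topology"
  have nonneg: "\<And>x. x \<in> topspace X \<Longrightarrow> 0 \<le> F x" using F01 by auto
  have "continuous_map ?P euclideanreal (\<lambda>z. (\<lambda>(t, x). F (T t x)) z + norm (fst z))"
    by (intro continuous_map_add continuous_map_action F continuous_map_norm continuous_map_fst)
  then have cont: "continuous_map ?P euclideanreal (\<lambda>(t, x). F (T t x) + norm t)"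
    by (simp add: case_prod_unfold)
  have "{x \<in> topspace X. infconv F x \<le> a} = {x \<in> topspace X. \<exists>t\<in>cball 0 1. F (T t x) + norm t \<in> {..a}}"
  proof (intro Collect_cong conj_cong refl iffI)
    fix x assume x: "x \<in> topspace X"
    show "\<exists>t\<in>cball 0 1. F (T t x) + norm t \<in> {..a}" if le: "infconv F x \<le> a"
    proof -
      obtain t where "norm t \<le> 1" "infconv F x = F (T t x) + norm t"
        using infconv_attained[OF F F01 x] .
      with le show ?thesis by (intro bexI[of _ t]) auto
    qed
    show "infconv F x \<le> a" if ex: "\<exists>t\<in>cball 0 1. F (T t x) + norm t \<in> {..a}"
    proof -
      obtain t where "F (T t x) + norm t \<le> a" using ex by auto
      with infconv_le[of F x t, OF nonneg x] show ?thesis by linarith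
    qed
  qed
  then show "closedin X {x \<in> topspace X. infconv F x \<le> a}"
    using closedin_compact_projection_euclidean[OF cont compact_cball closed_atMost] by simp
  have "{x \<in> topspace X. infconv F x < a} = (\<Union>t. {x \<in> topspace X. F (T t x) + norm t \<in> {..<a}})"
  proof -
    have "infconv F x < a \<longleftrightarrow> (\<exists>t. F (T t x) + norm t < a)" if x: "x \<in> topspace X" for x
    proof
      show "infconv F x < a \<Longrightarrow> \<exists>t. F (T t x) + norm t < a"
        using infconv_attained[OF F F01 x] by metis
      show "\<exists>t. F (T t x) + norm t < a \<Longrightarrow> infconv F x < a"
        using infconv_le[of F x, OF nonneg x] le_less_trans by blast
    qed
    then show ?thesis by auto
  qed
  moreover have "openin X {x \<in> topspace X. F (T t x) + norm t \<in> {..<a}}" for t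
  proof (rule openin_continuous_map_preimage)
    show "continuous_map X euclideanreal (\<lambda>x. F (T t x) + norm t)"
      by (rule continuous_map_add[OF continuous_map_time[OF F]]) simp
  qed auto
  ultimately show "openin X {x \<in> topspace X. infconv F x < a}"
    by auto
qed

text \<open>If all times of norm below \<open>r\<close> fixed \<open>p\<close>, so would every
  \<open>t\<close>, being the \<open>N\<close>-th multiple of the short time
  \<open>t / N\<close>.\<close>

lemma arbitrarily_small_displacement:
  assumes p: "p \<in> topspace X" "p \<notin> fixed_points X T" and "r > 0"
  obtains t where "norm t < r" and "T t p \<noteq> p"
proof -
  have "\<exists>t. norm t < r \<and> T t p \<noteq> p"
  proof (rule ccontr)
    assume "\<not> ?thesis"
    then have small: "T t p = p" if "norm t < r" for t
      using that by blast
    have "T t p = p" for t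
    proof -
      obtain N :: nat where N: "norm t / r < real N"
        using reals_Archimedean2 by blast
      then have "N > 0"
        using \<open>r > 0\<close> by (cases N) (auto simp: divide_less_0_iff)
      have "norm (t /\<^sub>R real N) < r"
        using N \<open>r > 0\<close> \<open>N > 0\<close> by (simp add: field_simps)
      then have step: "T (t /\<^sub>R real N) p = p" by (rule small)
      have "T (real n *\<^sub>R (t /\<^sub>R real N)) p = p" for n
      proof (induction n)
        case (Suc n)
        have "T (real (Suc n) *\<^sub>R (t /\<^sub>R real N)) p = T (real n *\<^sub>R (t /\<^sub>R real N)) (T (t /\<^sub>R real N) p)"
          using p(1) by (simp add: algebra_simps add_divide_distrib del: scaleR_scaleR)
        with Suc step show ?case by simp
      qed (simp add: p)
      from this[of N] show ?thesis using \<open>N > 0\<close> by simp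
    qed
    with p show False by (simp add: fixed_points_def)
  qed
  with that show thesis by blast
qed

end

section \<open>Oscillation along a path, peak functions, countable subcovers\<close>

lemma cos_extrema_in_period:
  fixes \<alpha> :: real
  shows "\<exists>z\<in>{\<alpha>..\<alpha> + 2 * pi}. cos z = 1" and "\<exists>z\<in>{\<alpha>..\<alpha> + 2 * pi}. cos z = -1"
proof -
  have *: "\<exists>z\<in>{\<beta>..\<beta> + 2 * pi}. cos z = 1" for \<beta> :: real
  proof (intro bexI)
    let ?k = "\<lceil>\<beta> / (2 * pi)\<rceil>"
    show "cos ((2 * pi) * of_int ?k) = 1" by (rule cos_int_2pin)
    have "\<beta> / (2 * pi) \<le> of_int ?k" "of_int ?k \<le> \<beta> / (2 * pi) + 1"
      by (simp_all add: of_int_ceiling_le_add_one)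
    then have "(2 * pi) * (\<beta> / (2 * pi)) \<le> (2 * pi) * of_int ?k"
      and "(2 * pi) * of_int ?k \<le> (2 * pi) * (\<beta> / (2 * pi) + 1)"
      by (intro mult_left_mono; simp)+
    then show "(2 * pi) * of_int ?k \<in> {\<beta>..\<beta> + 2 * pi}"
      by (simp add: distrib_left)
  qed
  show "\<exists>z\<in>{\<alpha>..\<alpha> + 2 * pi}. cos z = 1" by (rule *)
  obtain z where "z \<in> {\<alpha> - pi..\<alpha> - pi + 2 * pi}" "cos z = 1"
    using *[of "\<alpha> - pi"] by blast
  then show "\<exists>z\<in>{\<alpha>..\<alpha> + 2 * pi}. cos z = -1"
    by (intro bexI[of _ "z + pi"]) auto
qed

text \<open>Cut \<open>[0,1]\<close> into \<open>N\<close> equal pieces. On one of them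
  \<open>w\<close> changes by at least \<open>c / N\<close>, so by the intermediate value theorem
  \<open>M * w\<close> sweeps a full period of the cosine there.\<close>

lemma steep_oscillation:
  fixes w :: "real \<Rightarrow> real"
  assumes w: "continuous_on {0..1} w" and "N > 0" and "c > 0" and gap: "\<bar>w 1 - w 0\<bar> \<ge> c"
    and M: "M * c \<ge> 2 * pi * real N"
  obtains s s' where "s \<in> {0..1}" "s' \<in> {0..1}" "\<bar>s - s'\<bar> \<le> 1 / real N"
    and "cos (M * w s) = -1" and "cos (M * w s') = 1"
proof -
  let ?v = "\<lambda>i. w (real i / real N)"
  have "\<exists>i<N. \<bar>?v (Suc i) - ?v i\<bar> \<ge> c / N"
  proof (rule ccontr)
    assume "\<not> ?thesis"
    then have less: "\<bar>?v (Suc i) - ?v i\<bar> < c / N" if "i < N" for i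
      using that by force
    have "w 1 - w 0 = (\<Sum>i<N. ?v (Suc i) - ?v i)"
      using \<open>N > 0\<close> by (subst sum_lessThan_telescope) simp
    then have "\<bar>w 1 - w 0\<bar> \<le> (\<Sum>i<N. \<bar>?v (Suc i) - ?v i\<bar>)"
      by (simp add: sum_abs)
    also have "\<dots> < (\<Sum>i<N. c / N)"
      using \<open>N > 0\<close> less by (intro sum_strict_mono) auto
    also have "\<dots> = c" using \<open>N > 0\<close> by simp
    finally show False using gap by simp
  qed
  then obtain i where i: "i < N" "\<bar>?v (Suc i) - ?v i\<bar> \<ge> c / N" by blast
  let ?I = "{real i / N..real (Suc i) / N}"
  have I: "?I \<subseteq> {0..1}"
    using i(1) by (auto simp: field_simps intro: order_trans)
  define lo where "lo = min (?v i) (?v (Suc i))"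
  define hi where "hi = max (?v i) (?v (Suc i))"
  have mem: "real i / N \<in> ?I" "real (Suc i) / N \<in> ?I"
    using \<open>N > 0\<close> by (auto simp: divide_right_mono)
  have "connected (w ` ?I)"
    by (intro connected_continuous_image continuous_on_subset[OF w I] connected_Icc)
  moreover have "lo \<in> w ` ?I" "hi \<in> w ` ?I"
    using mem by (auto simp: lo_def hi_def min_def max_def)
  ultimately have sub: "{lo..hi} \<subseteq> w ` ?I"
    by (rule connected_contains_Icc)
  have "M > 0"
  proof -
    have "0 < 2 * pi * real N" using \<open>N > 0\<close> by simp
    with M have "0 < M * c" by linarith
    with \<open>c > 0\<close> show ?thesis by (simp add: zero_less_mult_iff)
  qed
  have "hi - lo \<ge> c / N" using i(2) by (auto simp: lo_def hi_def)
  then have "M * (hi - lo) \<ge> M * (c / N)"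
    using \<open>M > 0\<close> by (intro mult_left_mono) auto
  moreover have "M * (c / N) \<ge> 2 * pi"
    using M \<open>N > 0\<close> by (simp add: field_simps)
  ultimately have period: "M * lo + 2 * pi \<le> M * hi" by (simp add: algebra_simps)
  have attain: "\<exists>s\<in>?I. M * w s = z" if "z \<in> {M * lo..M * lo + 2 * pi}" for z
  proof -
    have "z / M \<in> {lo..hi}"
      using that period \<open>M > 0\<close> by (auto simp: field_simps)
    then obtain s where "s \<in> ?I" "w s = z / M" using sub by (metis imageE subsetD)
    then show ?thesis using \<open>M > 0\<close> by (intro bexI[of _ s]) auto
  qed
  obtain s where s: "s \<in> ?I" "cos (M * w s) = -1"
    using cos_extrema_in_period(2)[of "M * lo"] attain by metis
  obtain s' where s': "s' \<in> ?I" "cos (M * w s') = 1"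
    using cos_extrema_in_period(1)[of "M * lo"] attain by metis
  have "real (Suc i) / N = real i / N + 1 / N" by (simp add: add_divide_distrib)
  then have "\<bar>s - s'\<bar> \<le> 1 / N" using s(1) s'(1) by (auto simp: abs_le_iff)
  with s s' I that show thesis by blast
qed

text \<open>The strict maximum at \<open>p\<close> detects every displacement of \<open>p\<close>,
  while \<open>w\<close> vanishes near the set \<open>C\<close> that a perturbation must leave
  alone. The peak has half the radius of a ball around \<open>p\<close> avoiding
  \<open>C\<close>.\<close>

lemma metrizable_peak_function:
  assumes "metrizable_space X" and C: "closedin X C" and p: "p \<in> topspace X" "p \<notin> C"
  obtains w V where "continuous_map X euclideanreal w" and "\<And>x. x \<in> topspace X \<Longrightarrow> x \<noteq> p \<Longrightarrow> w x < w p"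
    and "openin X V" and "C \<subseteq> V" and "\<And>x. x \<in> V \<Longrightarrow> w x = 0"
proof -
  obtain M d where "Metric_space M d" and X: "X = Metric_space.mtopology M d"
    using assms(1) by (auto simp: metrizable_space_def)
  then interpret Metric_space M d by simp
  have "openin mtopology (M - C)" and "p \<in> M - C"
    using C p by (auto simp: X)
  then obtain c where "c > 0" and c: "mball p c \<subseteq> M - C"
    unfolding openin_mtopology by blast
  have cont: "continuous_map X euclideanreal (d p)"
    using continuous_on_mdist[of p Self] p(1) by (simp add: X mtopology_of_def)
  show thesis
  proof
    show "continuous_map X euclideanreal (\<lambda>x. max 0 (c / 2 - d p x))"
      by (intro continuous_map_real_max continuous_map_diff cont) auto
    show "max 0 (c / 2 - d p x) < max 0 (c / 2 - d p p)" if "x \<in> topspace X" "x \<noteq> p" for x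
      using that p \<open>c > 0\<close> mdist_pos_less[of p x] by (auto simp: X max_def)
    show "openin X {x \<in> topspace X. d p x \<in> {c / 2<..}}"
      by (rule openin_continuous_map_preimage[OF cont]) auto
    show "C \<subseteq> {x \<in> topspace X. d p x \<in> {c / 2<..}}"
    proof
      fix x assume "x \<in> C"
      then have "x \<in> M" using closedin_subset[OF C] by (auto simp: X)
      with \<open>x \<in> C\<close> c p have "\<not> d p x < c" by (auto simp: X)
      with \<open>x \<in> M\<close> \<open>c > 0\<close> show "x \<in> {x \<in> topspace X. d p x \<in> {c / 2<..}}" by (auto simp: X)
    qed
  qed auto
qed

text \<open>Baire's theorem allows only countably many conditions. An open set in a metrizable space
  is a countable union of closed sets, each compact here and so covered by finitely many members of
  \<open>\<U>\<close>.\<close>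

lemma countable_subcover_of_open:
  assumes "compact_space Y" and "metrizable_space Y" and op: "\<And>U. U \<in> \<U> \<Longrightarrow> openin Y U"
  obtains \<V> where "countable \<V>" "\<V> \<subseteq> \<U>" "\<Union>\<V> = \<Union>\<U>"
proof -
  have "fsigma_in Y (\<Union>\<U>)"
    using assms by (intro open_imp_fsigma_in) auto
  then obtain C :: "nat \<Rightarrow> 'a set" where C: "\<And>n. closedin Y (C n)" "\<Union>(range C) = \<Union>\<U>"
    by (auto simp: fsigma_in_ascending)
  have "\<exists>\<F>. finite \<F> \<and> \<F> \<subseteq> \<U> \<and> C n \<subseteq> \<Union>\<F>" for n
    using closedin_compact_space[OF assms(1) C(1)] op C(2)
    by (intro compactinD) auto
  then obtain \<F> where \<F>: "\<And>n. finite (\<F> n)" "\<And>n. \<F> n \<subseteq> \<U>" "\<And>n. C n \<subseteq> \<Union>(\<F> n)"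
    by metis
  show thesis
  proof
    show "countable (\<Union>n. \<F> n)" using \<F>(1) by (simp add: countable_finite)
    show "(\<Union>n. \<F> n) \<subseteq> \<U>" using \<F>(2) by blast
    have "\<Union>\<U> \<subseteq> (\<Union>n. \<Union>(\<F> n))"
      unfolding C(2)[symmetric] using \<F>(3) by (rule UN_mono[OF order_refl])
    moreover have "(\<Union>n. \<Union>(\<F> n)) \<subseteq> \<Union>\<U>"
      using \<F>(2) by (intro UN_least Union_mono)
    ultimately show "\<Union>(\<Union>n. \<F> n) = \<Union>\<U>" by blast
  qed
qed

context compact_flow
begin

subsection \<open>Separating points by a perturbation\<close>

text \<open>One \<open>e\<close> serves all of \<open>W\<close>, so for \<open>W\<close> inside
  \<open>X \<times> X\<close> the property survives small uniform perturbations of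
  \<open>f\<close>.\<close>

definition orbit_separates :: "('a \<Rightarrow> real) \<Rightarrow> ('a \<times> 'a) set \<Rightarrow> bool" where
  "orbit_separates f W \<longleftrightarrow> (\<exists>e>0. \<forall>(x, y)\<in>W. \<exists>t. \<bar>f (T t x) - f (T t y)\<bar> \<ge> e)"

lemma orbit_separatesI:
  assumes "e > 0" and "\<And>x y. (x, y) \<in> W \<Longrightarrow> \<exists>t. \<bar>f (T t x) - f (T t y)\<bar> \<ge> e"
  shows "orbit_separates f W"
  using assms unfolding orbit_separates_def by blast

lemma orbit_separates_cong:
  assumes "W \<subseteq> topspace X \<times> topspace X" and "\<And>x. x \<in> topspace X \<Longrightarrow> f x = g x"
  shows "orbit_separates f W \<longleftrightarrow> orbit_separates g W"
proof -
  have "f (T t x) = g (T t x) \<and> f (T t y) = g (T t y)" if "(x, y) \<in> W" for x y t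
    using assms that by auto
  then show ?thesis
    unfolding orbit_separates_def by (intro ex_cong1 conj_cong refl ball_cong) (auto split: prod.splits)
qed

lemma orbit_separates_swap:
  assumes "orbit_separates f (A \<times> B)"
  shows "orbit_separates f (B \<times> A)"
  using assms unfolding orbit_separates_def by (fastforce simp: abs_minus_commute)

end

text \<open>
  The function \<open>h\<close> prescribes the values on the fixed points. Its Lipschitz constant \<open>1/2\<close> and range
  \<open>[0,1/2]\<close> are not maximal, so mixing in a little of \<open>h\<close> makes room below the bounds \<open>1\<close> for
  perturbations.
\<close>

locale pinned_flow = compact_flow X T
  for X :: "'a topology" and T :: "real ^ 'n \<Rightarrow> 'a \<Rightarrow> 'a" +
  fixes h :: "'a \<Rightarrow> real"
  assumes cont_h: "continuous_map X euclideanreal h"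
    and h_range: "\<And>x. x \<in> topspace X \<Longrightarrow> h x \<in> {0..1/2}"
    and h_Lip: "\<And>x t. x \<in> topspace X \<Longrightarrow> \<bar>h (T t x) - h x\<bar> \<le> norm t / 2"
begin

text \<open>Each clause is preserved by uniform limits, so the restrictions of these functions to
  \<open>X\<close> form a complete space for the sup distance.\<close>

definition admissible :: "('a \<Rightarrow> real) \<Rightarrow> bool" where
  "admissible f \<longleftrightarrow> continuous_map X euclideanreal f \<and>
     (\<forall>x\<in>topspace X. f x \<in> {0..1} \<and> (\<forall>t. \<bar>f (T t x) - f x\<bar> \<le> norm t)) \<and>
     (\<forall>z\<in>fixed_points X T. f z = h z)"

lemma admissible_h: "admissible h"
  unfolding admissible_def
proof (intro conjI ballI allI)
  fix x t assume x: "x \<in> topspace X"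
  show "h x \<in> {0..1}" using h_range[OF x] by simp
  show "\<bar>h (T t x) - h x\<bar> \<le> norm t" using h_Lip[OF x, of t] norm_ge_zero[of t] by linarith
qed (simp_all add: cont_h)

text \<open>This is density, in the uniform distance, of the separating functions among the
  admissible ones.\<close>

definition generically_separable :: "('a \<times> 'a) set \<Rightarrow> bool" where
  "generically_separable W \<longleftrightarrow> (\<forall>f \<epsilon>. admissible f \<longrightarrow> \<epsilon> > 0 \<longrightarrow>
     (\<exists>g. admissible g \<and> (\<forall>x\<in>topspace X. \<bar>g x - f x\<bar> \<le> \<epsilon>) \<and> orbit_separates g W))"

lemma generically_separable_swap:
  "generically_separable (A \<times> B) \<Longrightarrow> generically_separable (B \<times> A)"
  unfolding generically_separable_def using orbit_separates_swap by blast

text \<open>With a peak function \<open>w\<close> at \<open>p\<close>, \<open>A\<close> collects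
  points for which \<open>w\<close> changes by at least \<open>c\<close> up to the short time
  \<open>t0\<close>, and \<open>B\<close> points whose orbits stay in the zero set of
  \<open>w\<close> for a while. An oscillation driven by \<open>w\<close> affects the former orbits
  and spares the latter.\<close>

lemma generically_separable_neighbourhoods_nonfixed:
  assumes p: "p \<in> topspace X" "p \<notin> fixed_points X T" and q: "q \<in> topspace X" and "p \<noteq> q"
  obtains A B where "openin X A" "openin X B" "p \<in> A" "q \<in> B" "generically_separable (A \<times> B)"
proof -
  have "closedin X (fixed_points X T \<union> {q})"
    using q Hausdorff_imp_t1_space[OF Hausdorff_X]
    by (intro closedin_Un closedin_fixed_points) (simp add: t1_space_closedin_singleton)
  then obtain w V where w: "continuous_map X euclideanreal w"
    and w_peak: "\<And>x. x \<in> topspace X \<Longrightarrow> x \<noteq> p \<Longrightarrow> w x < w p"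
    and V: "openin X V" "fixed_points X T \<union> {q} \<subseteq> V" and wV: "\<And>x. x \<in> V \<Longrightarrow> w x = 0"
    using metrizable_peak_function[OF metrizable_X, of "fixed_points X T \<union> {q}" p] p \<open>p \<noteq> q\<close>
    by (metis Un_iff singletonD)

  have "openin (prod_topology euclidean X) {z \<in> topspace (prod_topology euclidean X). (\<lambda>(t, x). T t x) z \<in> V}"
    by (rule openin_continuous_map_preimage[OF action_map V(1)])
  moreover have "(0, q) \<in> {z \<in> topspace (prod_topology euclidean X). (\<lambda>(t, x). T t x) z \<in> V}"
    using q V(2) by auto
  ultimately obtain U B where U: "openin euclidean U" "0 \<in> U" and B: "openin X B" "q \<in> B"
    and UB: "U \<times> B \<subseteq> {z \<in> topspace (prod_topology euclidean X). (\<lambda>(t, x). T t x) z \<in> V}"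
    unfolding openin_prod_topology_alt by blast
  obtain \<rho> where "\<rho> > 0" and \<rho>: "ball 0 \<rho> \<subseteq> U"
    using U by (auto elim: openE)
  \<comment> \<open>Times \<open>s\<close> and \<open>t + s\<close>, with \<open>s\<close> and
    \<open>t\<close> of norm at most \<open>r\<close>, must stay in the ball of radius
    \<open>\<rho>\<close>, where the orbits of \<open>B\<close> remain in \<open>V\<close>.\<close>
  define r where "r = \<rho> / 4"
  have "r > 0" using \<open>\<rho> > 0\<close> by (simp add: r_def)
  have B_top: "y \<in> topspace X" if "y \<in> B" for y
    using that B(1) openin_subset by blast
  have wB: "w (T t y) = 0" if "y \<in> B" "norm t \<le> 3 * r" for t y
  proof -
    have "t \<in> U" using that(2) \<open>\<rho> > 0\<close> \<rho> by (auto simp: r_def subset_iff)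
    with UB that(1) have "T t y \<in> V" by auto
    then show ?thesis by (rule wV)
  qed

  obtain t0 where t0: "norm t0 < r" "T t0 p \<noteq> p"
    using arbitrarily_small_displacement[OF p \<open>r > 0\<close>] .
  \<comment> \<open>A third of the drop of \<open>w\<close> from \<open>p\<close> to
    \<open>T t0 p\<close>: \<open>A\<close> gives up one third at either end and keeps the last one
    as its gap.\<close>
  define c where "c = (w p - w (T t0 p)) / 3"
  have "c > 0" using w_peak[of "T t0 p"] t0 p by (simp add: c_def)
  define A where "A = {x \<in> topspace X. w x \<in> {w p - c<..}} \<inter> {x \<in> topspace X. w (T t0 x) \<in> {..<w (T t0 p) + c}}"
  have A: "openin X A" unfolding A_def
    by (intro openin_Int openin_continuous_map_preimage[OF w]
          openin_continuous_map_preimage[OF continuous_map_time[OF w]]) auto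
  have A_top: "x \<in> topspace X" if "x \<in> A" for x
    using that by (simp add: A_def)
  have "p \<in> A" using p \<open>c > 0\<close> by (simp add: A_def)
  have A_gap: "\<bar>w (T t0 x) - w x\<bar> \<ge> c" if "x \<in> A" for x
  proof -
    have "w p - c < w x" "w (T t0 x) < w (T t0 p) + c"
      using that by (simp_all add: A_def)
    moreover have "w p - w (T t0 p) = 3 * c" by (simp add: c_def)
    ultimately show ?thesis by linarith
  qed

  have "generically_separable (A \<times> B)"
    unfolding generically_separable_def
  proof (intro allI impI)
    fix f :: "'a \<Rightarrow> real" and \<epsilon> :: real
    assume f: "admissible f" and "\<epsilon> > 0"
    have f_cont: "continuous_map X euclideanreal f"
      and f01: "\<And>x. x \<in> topspace X \<Longrightarrow> f x \<in> {0..1}"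
      and f_Lip: "\<And>x t. x \<in> topspace X \<Longrightarrow> \<bar>f (T t x) - f x\<bar> \<le> norm t"
      and f_fix: "\<And>z. z \<in> fixed_points X T \<Longrightarrow> f z = h z"
      using f by (auto simp: admissible_def)

    \<comment> \<open>The budget: \<open>f0\<close> moves by at most \<open>2 * \<eta>\<close> and
      the oscillation adds at most \<open>e \<le> \<eta>\<close>, within \<open>\<epsilon>\<close>
      in total.\<close>
    define \<eta> where "\<eta> = min (1/4) (\<epsilon> / 3)"
    have \<eta>: "0 < \<eta>" "\<eta> \<le> 1/4" "3 * \<eta> \<le> \<epsilon>" using \<open>\<epsilon> > 0\<close> by (auto simp: \<eta>_def)
    \<comment> \<open>Mixing in \<open>h\<close> brings the orbit slope and the upper bound down to
      \<open>1 - \<eta>\<close>. Fixed points keep their values, as \<open>f = h\<close>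
      there.\<close>
    define f0 where "f0 x = (1 - 2 * \<eta>) * f x + 2 * \<eta> * h x" for x
    have f0_cont: "continuous_map X euclideanreal f0"
      unfolding f0_def by (intro continuous_map_add continuous_map_real_mult f_cont cont_h) auto
    have f0_range: "0 \<le> f0 x" "f0 x \<le> 1 - \<eta>" if "x \<in> topspace X" for x
    proof -
      have "(1 - 2 * \<eta>) * f x \<le> (1 - 2 * \<eta>) * 1" "2 * \<eta> * h x \<le> 2 * \<eta> * (1/2)"
        using \<eta> f01[OF that] h_range[OF that] by (intro mult_left_mono; simp)+
      then show "f0 x \<le> 1 - \<eta>" by (simp add: f0_def)
      show "0 \<le> f0 x" using \<eta> f01[OF that] h_range[OF that] by (simp add: f0_def)
    qed
    have f0_near: "\<bar>f0 x - f x\<bar> \<le> 2 * \<eta>" if "x \<in> topspace X" for x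
    proof -
      have "f0 x - f x = 2 * \<eta> * (h x - f x)" by (simp add: f0_def algebra_simps)
      then have "\<bar>f0 x - f x\<bar> = 2 * \<eta> * \<bar>h x - f x\<bar>" using \<eta> by (simp add: abs_mult)
      also have "\<dots> \<le> 2 * \<eta> * 1"
        using \<eta> f01[OF that] h_range[OF that] by (intro mult_left_mono) auto
      finally show ?thesis by simp
    qed
    have f0_Lip: "\<bar>f0 (T t x) - f0 x\<bar> \<le> (1 - \<eta>) * norm t" if "x \<in> topspace X" for x t
    proof -
      have "f0 (T t x) - f0 x = (1 - 2 * \<eta>) * (f (T t x) - f x) + 2 * \<eta> * (h (T t x) - h x)"
        by (simp add: f0_def algebra_simps)
      also have "\<bar>\<dots>\<bar> \<le> (1 - 2 * \<eta>) * \<bar>f (T t x) - f x\<bar> + 2 * \<eta> * \<bar>h (T t x) - h x\<bar>"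
        using \<eta> by (intro order_trans[OF abs_triangle_ineq]) (simp add: abs_mult)
      also have "\<dots> \<le> (1 - 2 * \<eta>) * norm t + 2 * \<eta> * (norm t / 2)"
        using \<eta> f_Lip[OF that, of t] h_Lip[OF that, of t] by (intro add_mono mult_left_mono) auto
      finally show ?thesis by (simp add: algebra_simps)
    qed

    \<comment> \<open>The bound \<open>\<eta>\<close> keeps \<open>f0 + k\<close> in
      \<open>[0,1]\<close>; the bound \<open>\<eta> * r\<close> confines the minimizers of the
      inf-convolution to norm at most \<open>r\<close>.\<close>
    define e where "e = min \<eta> (\<eta> * r)"
    have e: "0 < e" "e \<le> \<eta>" "e \<le> \<eta> * r" using \<eta> \<open>r > 0\<close> by (auto simp: e_def)
    \<comment> \<open>\<open>N\<close> is so large that a crest and a trough of the oscillation, of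
      height \<open>e\<close>, occur within time \<open>e / 4\<close> of each other.\<close>
    obtain N :: nat where N: "4 * norm t0 / e < real N"
      using reals_Archimedean2 by blast
    have "0 \<le> 4 * norm t0 / e" using e by simp
    with N have "N > 0" by (cases N) auto
    have N': "norm t0 / N \<le> e / 4"
      using N e \<open>N > 0\<close> by (simp add: field_simps)
    define M where "M = 2 * pi * real N / c"
    \<comment> \<open>The oscillation runs between 0 and \<open>e\<close> and vanishes where
      \<open>w\<close> does, because \<open>cos 0 = 1\<close>.\<close>
    define k where "k x = e * ((1 - cos (M * w x)) / 2)" for x
    define F where "F x = f0 x + k x" for x
    have k_range: "0 \<le> k x" "k x \<le> e" for x
    proof -
      have "(1 - cos (M * w x)) / 2 \<in> {0..1}"
        using cos_le_one[of "M * w x"] cos_ge_minus_one[of "M * w x"] by simp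
      then show "0 \<le> k x" "k x \<le> e" using e by (auto simp: k_def mult_left_le)
    qed
    have k_cont: "continuous_map X euclideanreal k"
    proof -
      have "continuous_map euclideanreal euclideanreal (\<lambda>z. e * ((1 - cos (M * z)) / 2))"
        by (simp add: continuous_intros)
      from continuous_map_compose[OF w this] show ?thesis
        by (simp add: comp_def k_def[abs_def])
    qed
    have F_cont: "continuous_map X euclideanreal F"
      unfolding F_def by (intro continuous_map_add f0_cont k_cont)
    have F01: "F x \<in> {0..1}" if "x \<in> topspace X" for x
      using f0_range[OF that] k_range[of x] e by (auto simp: F_def)
    have F_nonneg: "0 \<le> F x" if "x \<in> topspace X" for x
      using F01[OF that] by simp

    define G where "G = infconv F"
    have G_le: "G x \<le> F (T t x) + norm t" if "x \<in> topspace X" for x t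
      unfolding G_def by (rule infconv_le[OF F_nonneg that])
    \<comment> \<open>Moving by \<open>t\<close> costs \<open>norm t\<close> and lowers
      \<open>f0\<close> by at most \<open>(1 - \<eta>) * norm t\<close>, a net loss of at least
      \<open>\<eta> * norm t\<close>, whereas at most \<open>e\<close> can be gained from
      \<open>k\<close>.\<close>
    have G_minimizer: "\<exists>t. norm t \<le> r \<and> G x = F (T t x) + norm t" if x: "x \<in> topspace X" for x
    proof -
      obtain t where t: "G x = F (T t x) + norm t"
        using infconv_attained[OF F_cont F01 x] unfolding G_def by blast
      have "f0 x - (1 - \<eta>) * norm t + norm t \<le> f0 (T t x) + norm t"
        using f0_Lip[OF x, of t] by linarith
      also have "\<dots> \<le> G x" using t k_range[of "T t x"] by (simp add: F_def)
      also have "\<dots> \<le> f0 x + e" using G_le[OF x, of 0] x k_range[of x] by (simp add: F_def)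
      finally have "\<eta> * norm t \<le> e" by (simp add: algebra_simps)
      also note \<open>e \<le> \<eta> * r\<close>
      finally have "norm t \<le> r" using \<eta> by simp
      with t show ?thesis by blast
    qed
    \<comment> \<open>\<open>f0\<close> is itself 1-Lipschitz along orbits and below
      \<open>F\<close>, so it stays below the inf-convolution.\<close>
    have f0_le_G: "f0 x \<le> G x" if x: "x \<in> topspace X" for x
    proof -
      obtain t where "G x = F (T t x) + norm t" using G_minimizer[OF x] by blast
      moreover have "(1 - \<eta>) * norm t \<le> 1 * norm t" using \<eta> by (intro mult_right_mono) auto
      ultimately show ?thesis
        using f0_Lip[OF x, of t] k_range[of "T t x"] by (simp add: F_def)
    qed
    have G_le_f0: "G x \<le> f0 x + k x" if x: "x \<in> topspace X" for x
      using G_le[OF x, of 0] x by (simp add: F_def)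
    have k_0: "k x = 0" if "w x = 0" for x
      using that by (simp add: k_def)

    have G_admissible: "admissible G"
      unfolding admissible_def
    proof (intro conjI ballI allI)
      show "continuous_map X euclideanreal G"
        unfolding G_def by (rule continuous_map_infconv[OF F_cont F01])
      fix x t assume x: "x \<in> topspace X"
      show "G x \<in> {0..1}" unfolding G_def by (rule infconv_in_unit_interval[OF F_cont F01 x])
      show "\<bar>G (T t x) - G x\<bar> \<le> norm t" unfolding G_def by (rule infconv_Lipschitz[OF F_cont F01 x])
    next
      fix z assume z: "z \<in> fixed_points X T"
      then have "k z = 0" using V wV k_0 by blast
      moreover have "G z = F z"
        unfolding G_def using z F_nonneg fixed_points_subset by (intro infconv_fixed) auto
      ultimately show "G z = h z" using f_fix[OF z] by (simp add: F_def f0_def algebra_simps)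
    qed
    have G_near: "\<bar>G x - f x\<bar> \<le> \<epsilon>" if x: "x \<in> topspace X" for x
      using f0_le_G[OF x] G_le_f0[OF x] k_range[of x] f0_near[OF x] e \<eta> by linarith
    \<comment> \<open>The sandwich \<open>f0 \<le> G \<le> f0 + k\<close> closes where
      \<open>k\<close> vanishes, so \<open>G\<close> inherits the slope bound of \<open>f0\<close>
      there.\<close>
    have G_B: "G (T t y) = f0 (T t y)" if "y \<in> B" "norm t \<le> 2 * r" for t y
    proof -
      have y: "T t y \<in> topspace X" using B_top that(1) by simp
      have "k (T t y) = 0" using that \<open>r > 0\<close> by (intro k_0 wB) auto
      then show ?thesis using f0_le_G[OF y] G_le_f0[OF y] by simp
    qed

    \<comment> \<open>The bound \<open>e / 2\<close> matches the drop of \<open>G\<close> below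
      \<open>F\<close> found at a crest. As \<open>\<rho>'\<close> is independent of the point, the
      minimizing times at crests are bounded below uniformly on \<open>A\<close>.\<close>
    obtain \<rho>' where "\<rho>' > 0" and \<rho>': "\<And>t x. x \<in> topspace X \<Longrightarrow> norm t < \<rho>' \<Longrightarrow> \<bar>F (T t x) - F x\<bar> < e / 2"
      using uniform_continuity_along_orbits[OF F_cont, of "e / 2"] e by auto
    (* Consecutive extrema of the oscillation force the minimizer t of G at T s x away from 0; along
       the way to it, G drops with slope exactly 1. *)
    have G_A: "\<exists>s t. norm s \<le> r \<and> norm t \<le> r \<and> \<rho>' \<le> norm t \<and> G (T (t + s) x) \<le> G (T s x) - norm t"
      if "x \<in> A" for x
    proof -
      have x: "x \<in> topspace X" by (rule A_top[OF that])
      have "continuous_on {0..1} (\<lambda>s. w (T (s *\<^sub>R t0) x))"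
        by (rule continuous_on_compose2[OF continuous_on_orbit[OF w x, of UNIV]]) (auto intro!: continuous_intros)
      moreover have "c \<le> \<bar>w (T (1 *\<^sub>R t0) x) - w (T (0 *\<^sub>R t0) x)\<bar>"
        using A_gap[OF that] x by simp
      moreover have "2 * pi * real N \<le> M * c" using \<open>c > 0\<close> by (simp add: M_def)
      ultimately obtain a b where ab: "a \<in> {0..1}" "b \<in> {0..1}" "\<bar>a - b\<bar> \<le> 1 / N"
        and cos_a: "cos (M * w (T (a *\<^sub>R t0) x)) = -1" and cos_b: "cos (M * w (T (b *\<^sub>R t0) x)) = 1"
        using steep_oscillation[of "\<lambda>s. w (T (s *\<^sub>R t0) x)" N c M] \<open>N > 0\<close> \<open>c > 0\<close> by blast
      define s where "s = a *\<^sub>R t0"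
      define u where "u = (b - a) *\<^sub>R t0"
      have u: "T u (T s x) = T (b *\<^sub>R t0) x" using x by (simp add: u_def s_def algebra_simps)
      have s_top: "T s x \<in> topspace X" using x by simp
      have "norm s \<le> r"
        using ab(1) t0(1) mult_mono[of a 1 "norm t0" r] \<open>r > 0\<close> by (simp add: s_def)
      have "norm u \<le> e / 4"
      proof -
        have "norm u = \<bar>a - b\<bar> * norm t0" by (simp add: u_def abs_minus_commute)
        also have "\<dots> \<le> 1 / N * norm t0" using ab(3) by (rule mult_right_mono) simp
        also have "\<dots> \<le> e / 4" using N' by simp
        finally show ?thesis .
      qed
      have "(1 - \<eta>) * norm u \<le> 1 * norm u" using \<eta> by (intro mult_right_mono) auto
      then have "f0 (T u (T s x)) \<le> f0 (T s x) + norm u"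
        using f0_Lip[OF s_top, of u] by linarith
      \<comment> \<open>At time \<open>s\<close> the oscillation is at a crest, after the further
        time \<open>u\<close> in a trough. Of the gain \<open>e\<close>, the slope of
        \<open>f0\<close> and the cost of moving consume at most \<open>e / 4\<close> each.\<close>
      moreover have "k (T s x) = e" "k (T u (T s x)) = 0"
        unfolding u using cos_a cos_b by (simp_all add: k_def s_def)
      ultimately have "F (T u (T s x)) + norm u \<le> F (T s x) - e / 2"
        using \<open>norm u \<le> e / 4\<close> by (simp add: F_def)
      with G_le[OF s_top, of u] have drop: "G (T s x) \<le> F (T s x) - e / 2" by linarith
      obtain t where t: "norm t \<le> r" "G (T s x) = F (T t (T s x)) + norm t"
        using G_minimizer[OF s_top] by blast
      have "\<not> norm t < \<rho>'"
      proof
        assume "norm t < \<rho>'"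
        then have "\<bar>F (T t (T s x)) - F (T s x)\<bar> < e / 2" by (rule \<rho>'[OF s_top])
        with drop t(2) norm_ge_zero[of t] show False by linarith
      qed
      moreover have "G (T (t + s) x) \<le> G (T s x) - norm t"
        using G_le[of "T t (T s x)" 0] t(2) x by simp
      ultimately show ?thesis using t(1) \<open>norm s \<le> r\<close> by (intro exI[of _ s] exI[of _ t]) auto
    qed

    have "orbit_separates G (A \<times> B)"
    proof (rule orbit_separatesI)
      \<comment> \<open>Between the times \<open>s\<close> and \<open>t + s\<close>,
        \<open>G\<close> drops by at least \<open>norm t\<close> on the orbit of \<open>x\<close>
        but by at most \<open>(1 - \<eta>) * norm t\<close> on that of \<open>y\<close>. The drops
        differ by at least \<open>\<eta> * \<rho>'\<close>, so at one of the two times the values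
        differ by at least half of it.\<close>
      show "\<eta> * \<rho>' / 2 > 0" using \<eta> \<open>\<rho>' > 0\<close> by simp
      fix x y assume "(x, y) \<in> A \<times> B"
      then have xy: "x \<in> A" "y \<in> B" by auto
      obtain s t where st: "norm s \<le> r" "norm t \<le> r" "\<rho>' \<le> norm t"
        and slope: "G (T (t + s) x) \<le> G (T s x) - norm t"
        using G_A[OF xy(1)] by blast
      have "norm (t + s) \<le> 2 * r" using norm_triangle_ineq[of t s] st by linarith
      moreover have "norm s \<le> 2 * r" using st \<open>r > 0\<close> by simp
      ultimately have "G (T (t + s) y) = f0 (T t (T s y))" "G (T s y) = f0 (T s y)"
        using G_B[OF xy(2)] B_top[OF xy(2)] by simp_all
      moreover have "\<bar>f0 (T t (T s y)) - f0 (T s y)\<bar> \<le> (1 - \<eta>) * norm t"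
        using B_top[OF xy(2)] by (intro f0_Lip) simp
      ultimately have "G (T s y) - G (T (t + s) y) \<le> norm t - \<eta> * norm t"
        by (simp add: algebra_simps)
      moreover have "\<eta> * \<rho>' \<le> \<eta> * norm t" using st(3) \<eta> by simp
      ultimately have "\<eta> * \<rho>' / 2 \<le> \<bar>G (T s x) - G (T s y)\<bar> \<or> \<eta> * \<rho>' / 2 \<le> \<bar>G (T (t + s) x) - G (T (t + s) y)\<bar>"
        using slope by linarith
      then show "\<exists>t. \<eta> * \<rho>' / 2 \<le> \<bar>G (T t x) - G (T t y)\<bar>" by blast
    qed
    with G_admissible G_near
    show "\<exists>g. admissible g \<and> (\<forall>x\<in>topspace X. \<bar>g x - f x\<bar> \<le> \<epsilon>) \<and> orbit_separates g (A \<times> B)"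
      by blast
  qed
  with A B \<open>p \<in> A\<close> that show thesis by blast
qed

subsection \<open>The generic function and the embedding\<close>

text \<open>Baire's theorem in the complete space \<open>E\<close>: countably many boxes cover all
  pairs of distinct points with a non-fixed member, and separation on each box is an open dense
  condition.\<close>

lemma separating_admissible_function:
  obtains f where "admissible f"
    and "\<And>x y. x \<in> topspace X \<Longrightarrow> y \<in> topspace X \<Longrightarrow> x \<noteq> y \<Longrightarrow>
      x \<notin> fixed_points X T \<or> y \<notin> fixed_points X T \<Longrightarrow> \<exists>t. f (T t x) \<noteq> f (T t y)"
proof -
  define m where "m = (cfunspace X euclidean_metric :: ('a \<Rightarrow> real) metric)"
  interpret C: Metric_space "mspace m" "mdist m"
    by (rule Metric_space_mspace_mdist)
  define E where "E = {f \<in> mspace m. admissible f}"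
  have mspace: "mspace m = {f \<in> extensional (topspace X). continuous_map X euclideanreal f}"
    unfolding m_def compactin_mspace_cfunspace[OF compact_X[unfolded compact_space_def]] by auto
  have dist_ge: "\<bar>f x - g x\<bar> \<le> mdist m f g" if "f \<in> mspace m" "g \<in> mspace m" "x \<in> topspace X" for f g x
    using mdist_cfunspace_imp_mdist_le[OF that(1,2)[unfolded m_def] order_refl that(3)]
    by (simp add: m_def dist_real_def)
  have dist_le: "mdist m f g \<le> e" if "e > 0" "\<And>x. x \<in> topspace X \<Longrightarrow> \<bar>f x - g x\<bar> \<le> e" for f g e
    unfolding m_def using that by (intro mdist_cfunspace_le) (auto simp: dist_real_def)
  \<comment> \<open>Points of \<open>cfunspace\<close> are extensional, so admissible functions
    enter it through their restrictions to \<open>X\<close>.\<close>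
  have restrict_admissible: "restrict f (topspace X) \<in> E" if "admissible f" for f
  proof -
    have cont: "continuous_map X euclideanreal (restrict f (topspace X))"
      using that by (auto simp: admissible_def elim: continuous_map_eq)
    then have "admissible (restrict f (topspace X))"
      using that fixed_points_subset by (auto simp: admissible_def)
    with cont show ?thesis by (simp add: E_def mspace)
  qed

  have "C.mcomplete"
    using Met_TC.mcomplete_cfunspace[of X] complete_UNIV
    unfolding m_def mcomplete_of_def euclidean_metric_def Met_TC.Self_def by simp
  \<comment> \<open>Convergence in the metric is in particular pointwise, so range, slope and fixed
    values pass to the limit. Continuity is part of membership in \<open>mspace m\<close>.\<close>
  have limit_in_E: "l \<in> E" if \<sigma>: "range \<sigma> \<subseteq> E" and lim: "limitin C.mtopology \<sigma> l sequentially" for \<sigma> l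
  proof -
    have l: "l \<in> mspace m" using lim C.limitin_mspace by blast
    have \<sigma>_mem: "\<sigma> n \<in> mspace m" "admissible (\<sigma> n)" for n using \<sigma> by (auto simp: E_def)
    have dist_lim: "(\<lambda>n. mdist m (\<sigma> n) l) \<longlonglongrightarrow> 0"
      using lim by (simp add: C.limitin_metric_dist_null)
    have pt: "(\<lambda>n. \<sigma> n x) \<longlonglongrightarrow> l x" if "x \<in> topspace X" for x
    proof (rule Lim_null_comparison[THEN LIM_zero_cancel])
      show "\<forall>\<^sub>F n in sequentially. norm (\<sigma> n x - l x) \<le> mdist m (\<sigma> n) l"
        using dist_ge[OF \<sigma>_mem(1) l that] by simp
    qed (rule dist_lim)
    have "admissible l"
      unfolding admissible_def
    proof (intro conjI ballI allI)
      show "continuous_map X euclideanreal l" using l by (simp add: mspace)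
      fix x t assume x: "x \<in> topspace X"
      show "l x \<in> {0..1}"
        by (rule Lim_in_closed_set[OF closed_atLeastAtMost _ _ pt[OF x]])
          (use \<sigma>_mem(2) x in \<open>auto simp: admissible_def\<close>)
      have "(\<lambda>n. \<bar>\<sigma> n (T t x) - \<sigma> n x\<bar>) \<longlonglongrightarrow> \<bar>l (T t x) - l x\<bar>"
        using x by (intro tendsto_intros pt) auto
      then show "\<bar>l (T t x) - l x\<bar> \<le> norm t"
        by (rule LIMSEQ_le_const2) (use \<sigma>_mem(2) x in \<open>auto simp: admissible_def\<close>)
    next
      fix z assume z: "z \<in> fixed_points X T"
      then have "\<sigma> n z = h z" for n using \<sigma>_mem(2) by (auto simp: admissible_def)
      then show "l z = h z"
        using pt[of z] z fixed_points_subset LIMSEQ_unique[OF _ tendsto_const] by auto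
    qed
    with l show ?thesis by (simp add: E_def)
  qed
  interpret E: Submetric "mspace m" "mdist m" E
    by unfold_locales (auto simp: E_def)
  have "closedin C.mtopology E"
    unfolding C.metric_closedin_iff_sequentially_closed using limit_in_E E.subset by blast
  then have "E.sub.mcomplete"
    using E.closedin_eq_mcomplete[OF \<open>C.mcomplete\<close>] by blast

  define \<U> where "\<U> = {A \<times> B |A B. openin X A \<and> openin X B \<and> generically_separable (A \<times> B)}"
  have "\<And>W. W \<in> \<U> \<Longrightarrow> openin (prod_topology X X) W"
    by (auto simp: \<U>_def openin_prod_Times_iff)
  then obtain \<V> where \<V>: "countable \<V>" "\<V> \<subseteq> \<U>" "\<Union>\<V> = \<Union>\<U>"
    using countable_subcover_of_open[of "prod_topology X X" \<U>] compact_X metrizable_X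
    by (auto simp: compact_space_prod_topology metrizable_space_prod_topology)
  have \<V>_top: "W \<subseteq> topspace X \<times> topspace X" "generically_separable W" if "W \<in> \<V>" for W
    using that \<V>(2) by (auto simp: \<U>_def dest: openin_subset)

  define D where "D W = {f \<in> E. orbit_separates f W}" for W
  have D_open: "openin E.sub.mtopology (D W)" if W: "W \<in> \<V>" for W
    unfolding E.sub.openin_mtopology
  proof (intro conjI allI impI)
    show "D W \<subseteq> E" by (auto simp: D_def)
    fix f assume "f \<in> D W"
    then obtain e where "e > 0" and e: "\<And>x y. (x, y) \<in> W \<Longrightarrow> \<exists>t. \<bar>f (T t x) - f (T t y)\<bar> \<ge> e" and "f \<in> E"
      unfolding D_def orbit_separates_def by fast
    show "\<exists>r>0. E.sub.mball f r \<subseteq> D W"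
    \<comment> \<open>A gap of \<open>e\<close> loses less than \<open>e / 3\<close> at each of the
      two points, so \<open>e / 3\<close> remains.\<close>
    proof (intro exI[of _ "e / 3"] conjI subsetI)
      fix g assume "g \<in> E.sub.mball f (e / 3)"
      then have g: "g \<in> E" "mdist m f g < e / 3" by auto
      have near: "\<bar>f x - g x\<bar> < e / 3" if "x \<in> topspace X" for x
        using dist_ge[of f g x] that g \<open>f \<in> E\<close> by (auto simp: E_def)
      have "orbit_separates g W"
      proof (rule orbit_separatesI)
        fix x y assume xy: "(x, y) \<in> W"
        then have top: "x \<in> topspace X" "y \<in> topspace X" using \<V>_top[OF W] by auto
        obtain t where "\<bar>f (T t x) - f (T t y)\<bar> \<ge> e" using e[OF xy] by blast
        with near[of "T t x"] near[of "T t y"] top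
        have "\<bar>g (T t x) - g (T t y)\<bar> \<ge> e / 3" by (simp add: abs_if split: if_splits)
        then show "\<exists>t. \<bar>g (T t x) - g (T t y)\<bar> \<ge> e / 3" by blast
      qed (use \<open>e > 0\<close> in simp)
      with g show "g \<in> D W" by (simp add: D_def)
    qed (use \<open>e > 0\<close> in simp)
  qed
  have D_dense: "E.sub.mtopology closure_of D W = E" if W: "W \<in> \<V>" for W
  proof -
    have "\<exists>g\<in>D W. g \<in> E.sub.mball f r" if f: "f \<in> E" and "r > 0" for f r
    proof -
      obtain g where g: "admissible g" "\<And>x. x \<in> topspace X \<Longrightarrow> \<bar>g x - f x\<bar> \<le> r / 2" "orbit_separates g W"
        using \<V>_top(2)[OF W] f \<open>r > 0\<close> unfolding generically_separable_def E_def
        by (metis (mono_tags, lifting) half_gt_zero mem_Collect_eq)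
      let ?g = "restrict g (topspace X)"
      have "orbit_separates ?g W"
        using g(3) orbit_separates_cong[OF \<V>_top(1)[OF W], of ?g g] by simp
      moreover have "?g \<in> E" by (rule restrict_admissible[OF g(1)])
      moreover have "mdist m f ?g \<le> r / 2"
        using g(2) \<open>r > 0\<close> by (intro dist_le) (auto simp: abs_minus_commute)
      ultimately show ?thesis using f \<open>r > 0\<close> by (intro bexI[of _ ?g]) (auto simp: D_def)
    qed
    then show ?thesis unfolding E.sub.metric_closure_of by auto
  qed
  have "E.sub.mtopology closure_of \<Inter>(D ` \<V>) = E"
    using D_open D_dense \<V>(1)
    by (intro E.sub.metric_Baire_category \<open>E.sub.mcomplete\<close>) auto
  moreover have "E \<noteq> {}" using restrict_admissible[OF admissible_h] by blast
  \<comment> \<open>Intersecting with \<open>E\<close> also covers an empty \<open>\<V>\<close>, for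
    which the intersection of the family is \<open>UNIV\<close>.\<close>
  ultimately have "E \<inter> \<Inter>(D ` \<V>) \<noteq> {}"
    by (metis E.sub.topspace_mtopology closure_of_eq_empty_gen disjnt_def)
  then obtain f where "f \<in> E" and f: "\<And>W. W \<in> \<V> \<Longrightarrow> orbit_separates f W"
    by (auto simp: D_def)
  show thesis
  proof
    show "admissible f" using \<open>f \<in> E\<close> by (simp add: E_def)
    fix x y assume xy: "x \<in> topspace X" "y \<in> topspace X" "x \<noteq> y"
      and nonfixed: "x \<notin> fixed_points X T \<or> y \<notin> fixed_points X T"
    have "\<exists>A B. openin X A \<and> openin X B \<and> x \<in> A \<and> y \<in> B \<and> generically_separable (A \<times> B)"
      using nonfixed
    proof
      assume "x \<notin> fixed_points X T"
      from generically_separable_neighbourhoods_nonfixed[OF xy(1) this xy(2,3)] show ?thesis by metis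
    next
      assume "y \<notin> fixed_points X T"
      from generically_separable_neighbourhoods_nonfixed[OF xy(2) this xy(1) xy(3)[symmetric]]
      show ?thesis using generically_separable_swap by metis
    qed
    then have "(x, y) \<in> \<Union>\<V>" unfolding \<V>(3) \<U>_def by blast
    then obtain W where "W \<in> \<V>" "(x, y) \<in> W" by blast
    with f[of W] obtain e t where "e > 0" "\<bar>f (T t x) - f (T t y)\<bar> \<ge> e"
      unfolding orbit_separates_def by fast
    then show "\<exists>t. f (T t x) \<noteq> f (T t y)" by (intro exI[of _ t]) auto
  qed
qed

end

section \<open>The two directions of the equivalence\<close>

context compact_flow
begin

text \<open>Equivariance makes \<open>f z\<close> shift-invariant, hence constant, for fixed
  \<open>z\<close>; so its value at 0 determines it. Compactness upgrades the resulting continuous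
  injection to an embedding.\<close>

lemma embedding_of_fixed_points:
  assumes "equivariantly_embeds_in_Lip1 X T"
  shows "\<exists>g. embedding_map (subtopology X (fixed_points X T)) (top_of_set {0..1::real}) g"
proof -
  obtain f where f: "embedding_map X Lip1_topology f"
    and eqv: "\<And>t x. x \<in> topspace X \<Longrightarrow> f (T t x) = shift t (f x)"
    using assms by (auto simp: equivariantly_embeds_in_Lip1_def)
  have cont: "continuous_map X Lip1_topology f" and inj: "inj_on f (topspace X)"
    using f by (simp_all add: embedding_map_imp_continuous_map embedding_map_imp_injective)
  let ?F = "subtopology X (fixed_points X T)"
  have const: "f z t = f z 0" if "z \<in> fixed_points X T" for z t
  proof -
    have "f z = shift t (f z)"
      using that eqv[of z t] by (auto simp: fixed_points_def)
    from fun_cong[OF this, of 0] show ?thesis by (simp add: shift_def)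
  qed
  have "continuous_map X euclideanreal (\<lambda>x. f x 0)"
    using continuous_map_compose[OF cont continuous_map_Lip1_evaluation[of 0]] by (simp add: comp_def)
  moreover have "f x 0 \<in> {0..1}" if "x \<in> topspace X" for x
  proof -
    have "f x \<in> Lip1" using continuous_map_image_subset_topspace[OF cont] that by auto
    then show ?thesis unfolding Lip1_def by blast
  qed
  ultimately have "continuous_map ?F (top_of_set {0..1}) (\<lambda>x. f x 0)"
    by (auto simp: continuous_map_in_subtopology continuous_map_from_subtopology)
  moreover have "inj_on (\<lambda>x. f x 0) (topspace ?F)"
  proof (rule inj_onI)
    fix x y assume xy: "x \<in> topspace ?F" "y \<in> topspace ?F" "f x 0 = f y 0"
    then have "x \<in> fixed_points X T" "y \<in> fixed_points X T" by simp_all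
    with const[of x] const[of y] xy(3) have "f x = f y" by (intro ext) metis
    then show "x = y" by (rule inj_onD[OF inj]) (use xy in simp_all)
  qed
  moreover have "compact_space ?F"
    using closedin_compact_space[OF compact_X closedin_fixed_points] by (rule compact_space_subtopology)
  ultimately have "embedding_map ?F (top_of_set {0..1}) (\<lambda>x. f x 0)"
    by (intro continuous_imp_embedding_map Hausdorff_space_subtopology) auto
  then show ?thesis by blast
qed

lemma orbit_functions_embedding:
  assumes f: "continuous_map X euclideanreal f" and f01: "\<And>x. x \<in> topspace X \<Longrightarrow> f x \<in> {0..1}"
    and f_Lip: "\<And>x t. x \<in> topspace X \<Longrightarrow> \<bar>f (T t x) - f x\<bar> \<le> norm t"
    and sep: "\<And>x y. x \<in> topspace X \<Longrightarrow> y \<in> topspace X \<Longrightarrow> x \<noteq> y \<Longrightarrow> \<exists>t. f (T t x) \<noteq> f (T t y)"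
  shows "equivariantly_embeds_in_Lip1 X T"
proof -
  define I where "I x = (\<lambda>t. f (T t x))" for x
  have I_Lip1: "I x \<in> Lip1" if x: "x \<in> topspace X" for x
  proof -
    have "dist (I x s) (I x t) \<le> 1 * dist s t" for s t
      using f_Lip[of "T t x" "s - t"] x by (simp add: I_def dist_real_def dist_norm)
    then show ?thesis
      using f01 x by (auto simp: Lip1_def lipschitz_on_def I_def)
  qed
  have I_cont: "continuous_on UNIV (I x)" if "x \<in> topspace X" for x
    unfolding I_def by (rule continuous_on_orbit[OF f that])
  have "continuous_map X compact_open_topology I"
    unfolding compact_open_topology_def
  proof (rule continuous_on_generated_topo)
    fix W :: "(real ^ 'n \<Rightarrow> real) set"
    assume "W \<in> {{\<phi>. continuous_on UNIV \<phi> \<and> \<phi> ` K \<subseteq> U} | K U. compact K \<and> open U}"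
    then obtain K :: "(real ^ 'n) set" and U :: "real set"
      where W: "W = {\<phi>. continuous_on UNIV \<phi> \<and> \<phi> ` K \<subseteq> U}" and "compact K" "open U" by blast
    \<comment> \<open>A subbasic condition fails exactly when some time in \<open>K\<close> carries
      \<open>f\<close> out of \<open>U\<close>; such points form a projection along the compact set
      \<open>K\<close>.\<close>
    have "I -` W \<inter> topspace X = topspace X - {x \<in> topspace X. \<exists>t\<in>K. f (T t x) \<in> - U}"
      using I_cont by (auto simp: W I_def)
    moreover have "closedin X {x \<in> topspace X. \<exists>t\<in>K. f (T t x) \<in> - U}"
      using \<open>compact K\<close> \<open>open U\<close>
      by (intro closedin_compact_projection_euclidean continuous_map_action f) auto
    ultimately show "openin X (I -` W \<inter> topspace X)" by auto
  next
    have "I ` topspace X \<subseteq> topspace compact_open_topology"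
      using I_cont by (auto simp: topspace_compact_open_topology)
    then show "I ` topspace X \<subseteq> \<Union>{{\<phi>. continuous_on UNIV \<phi> \<and> \<phi> ` K \<subseteq> U} | K U. compact K \<and> open U}"
      unfolding compact_open_topology_def topology_generated_by_topspace .
  qed
  then have "continuous_map X Lip1_topology I"
    using I_Lip1 by (auto simp: Lip1_topology_def continuous_map_in_subtopology)
  moreover have "inj_on I (topspace X)"
    using sep by (intro inj_onI) (metis I_def)
  ultimately have "embedding_map X Lip1_topology I"
    by (intro continuous_imp_embedding_map compact_X Hausdorff_space_Lip1)
  moreover have "I (T t x) = shift t (I x)" if "x \<in> topspace X" for t x
    using that by (simp add: I_def shift_def)
  ultimately show ?thesis
    unfolding equivariantly_embeds_in_Lip1_def by blast
qed

lemma equivariant_embedding_if_fixed_points_embed: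
  assumes "embedding_map (subtopology X (fixed_points X T)) (top_of_set {0..1::real}) g"
  shows "equivariantly_embeds_in_Lip1 X T"
proof -
  let ?F = "fixed_points X T"
  have top: "topspace (subtopology X ?F) = ?F"
    using fixed_points_subset by auto
  have g: "continuous_map (subtopology X ?F) (top_of_set {0..1}) g" and inj: "inj_on g ?F"
    using embedding_map_imp_continuous_map[OF assms] embedding_map_imp_injective[OF assms] top by simp_all
  have "normal_space X"
    using metrizable_X by (rule metrizable_imp_normal_space)
  moreover have "continuous_map (subtopology X ?F) euclideanreal g" "g ` ?F \<subseteq> {0..1}"
    using g top by (auto simp: continuous_map_in_subtopology)
  ultimately obtain H where H: "continuous_map X euclideanreal H" "\<And>z. z \<in> ?F \<Longrightarrow> H z = g z"
    and "H ` topspace X \<subseteq> {0..1}"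
    using Tietze_extension_closed_real_interval[OF _ closedin_fixed_points] by (metis zero_le_one)
  then have H01: "H x \<in> {0..1}" if "x \<in> topspace X" for x using that by blast
  \<comment> \<open>Inf-convolution makes the Tietze extension \<open>H\<close> 1-Lipschitz along
    orbits without changing it on the fixed points. Halving gives the slope and range
    \<open>1/2\<close> required by \<open>pinned_flow\<close>, and \<open>g / 2\<close> is still
    injective.\<close>
  define h where "h x = infconv H x / 2" for x
  interpret pinned_flow X T h
  proof
    show "continuous_map X euclideanreal h"
      unfolding h_def by (intro continuous_map_real_divide continuous_map_infconv H H01) auto
    fix x assume x: "x \<in> topspace X"
    show "h x \<in> {0..1/2}"
      using infconv_in_unit_interval[OF H(1) H01 x] by (simp add: h_def)
    show "\<bar>h (T t x) - h x\<bar> \<le> norm t / 2" for t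
      using infconv_Lipschitz[OF H(1) H01 x, of t] by (simp add: h_def abs_if split: if_splits)
  qed
  have h_eq: "h z = g z / 2" if "z \<in> ?F" for z
    using infconv_fixed[OF that, of H] that H(2)[OF that] H01[of z] fixed_points_subset
    by (auto simp: h_def)
  obtain f where f: "admissible f"
    and sep: "\<And>x y. x \<in> topspace X \<Longrightarrow> y \<in> topspace X \<Longrightarrow> x \<noteq> y \<Longrightarrow>
      x \<notin> ?F \<or> y \<notin> ?F \<Longrightarrow> \<exists>t. f (T t x) \<noteq> f (T t y)"
    using separating_admissible_function by blast
  show ?thesis
  proof (rule orbit_functions_embedding)
    fix x y assume xy: "x \<in> topspace X" "y \<in> topspace X" "x \<noteq> y"
    show "\<exists>t. f (T t x) \<noteq> f (T t y)"
    proof (cases "x \<in> ?F \<and> y \<in> ?F")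
      case True
      then have "f x = g x / 2" "f y = g y / 2" using f h_eq by (simp_all add: admissible_def)
      moreover have "g x \<noteq> g y" using True inj xy(3) by (auto dest: inj_onD)
      ultimately have "f (T 0 x) \<noteq> f (T 0 y)" using xy by simp
      then show ?thesis by blast
    qed (use sep xy in blast)
  qed (use f in \<open>auto simp: admissible_def\<close>)
qed

end

theorem theorem1p7:
  fixes X :: "'a topology" and T :: "real ^ 'n \<Rightarrow> 'a \<Rightarrow> 'a"
  assumes "compact_space X" and "metrizable_space X"
    and "continuous_action X T"
  shows "equivariantly_embeds_in_Lip1 X T \<longleftrightarrow>
    (\<exists>g. embedding_map (subtopology X (fixed_points X T)) (top_of_set {0..1::real}) g)"
proof
  interpret compact_flow X T
    using assms by unfold_locales
  show "equivariantly_embeds_in_Lip1 X T \<Longrightarrow>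
      \<exists>g. embedding_map (subtopology X (fixed_points X T)) (top_of_set {0..1::real}) g"
    by (rule embedding_of_fixed_points)
  show "\<exists>g. embedding_map (subtopology X (fixed_points X T)) (top_of_set {0..1::real}) g \<Longrightarrow>
      equivariantly_embeds_in_Lip1 X T"
    using equivariant_embedding_if_fixed_points_embed by blast
qed

end
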